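(* Let $a,b$ be positive integers, and let $g_{a,b}(3)$ denote the least positive integer $g$ such that every element of $LQ_{a,b}^3$ can be written as a sum of at most $g$ cubes of elements of $LQ_{a,b}$. Then such a $g$ exists, and: (i) if $3 \nmid a$ or $3 \nmid b$, then $3 \leq g_{a,b}(3) \leq 6$; (ii) if $3 \mid a$ and $3 \mid b$, then $4 \leq g_{a,b}(3) \leq 5$.
   Context: For integers $a,b$, $LQ_{a,b}$ denotes the quaternion ring $\{\alpha_0 + \alpha_1 \mathbf{i} + \alpha_2 \mathbf{j} + \alpha_3 \mathbf{k} \mid \alpha_n \in \mathbb{Z}\}$ with multiplication determined by $\mathbf{i}^2 = -a$, $\mathbf{j}^2 = -b$, $\mathbf{i}\mathbf{j} = -\mathbf{j}\mathbf{i} = \mathbf{k}$ (so $\mathbf{k}^2=-ab$). $LQ_{a,b}^3$ denotes the additive subgroup of $LQ_{a,b}$ generated by all cubes $x^3$, $x \in LQ_{a,b}$. *)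

theory Defs
  imports "HOL-Algebra.Ring" "HOL-Algebra.Generated_Groups"
begin

datatype quat = Quat (qre: int) (qi: int) (qj: int) (qk: int)

text \<open>
  The product is the bilinear extension of \<open>i\<^sup>2 = -a\<close>, \<open>j\<^sup>2 = -b\<close>, \<open>ij = -ji = k\<close>, which by
  associativity force \<open>k\<^sup>2 = -ab\<close>, \<open>jk = -kj = bi\<close> and \<open>ki = -ik = aj\<close>.
\<close>

definition quat_mult :: "int \<Rightarrow> int \<Rightarrow> quat \<Rightarrow> quat \<Rightarrow> quat" where
  "quat_mult a b x y = Quat
     (qre x * qre y - a * qi x * qi y - b * qj x * qj y - a * b * qk x * qk y)
     (qre x * qi y + qi x * qre y + b * (qj x * qk y - qk x * qj y))
     (qre x * qj y + qj x * qre y + a * (qk x * qi y - qi x * qk y))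
     (qre x * qk y + qk x * qre y + qi x * qj y - qj x * qi y)"

definition quat_add :: "quat \<Rightarrow> quat \<Rightarrow> quat" where
  "quat_add x y = Quat (qre x + qre y) (qi x + qi y) (qj x + qj y) (qk x + qk y)"

definition LQ :: "int \<Rightarrow> int \<Rightarrow> quat ring" where
  "LQ a b = \<lparr>carrier = UNIV, mult = quat_mult a b, one = Quat 1 0 0 0,
             zero = Quat 0 0 0 0, add = quat_add\<rparr>"

lemma LQ_simps [simp]:
  "carrier (LQ a b) = UNIV"
  "x \<otimes>\<^bsub>LQ a b\<^esub> y = quat_mult a b x y"
  "\<one>\<^bsub>LQ a b\<^esub> = Quat 1 0 0 0"
  "\<zero>\<^bsub>LQ a b\<^esub> = Quat 0 0 0 0"
  "x \<oplus>\<^bsub>LQ a b\<^esub> y = quat_add x y"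
  by (simp_all add: LQ_def)

lemma ring_LQ: "ring (LQ a b)"
proof (rule ringI)
  show "abelian_group (LQ a b)"
  proof (rule abelian_groupI)
    fix x assume "x \<in> carrier (LQ a b)"
    show "\<exists>y\<in>carrier (LQ a b). y \<oplus>\<^bsub>LQ a b\<^esub> x = \<zero>\<^bsub>LQ a b\<^esub>"
      by (rule bexI[of _ "Quat (- qre x) (- qi x) (- qj x) (- qk x)"]) (auto simp: quat_add_def)
  qed (auto simp: quat_add_def quat.expand)
  show "monoid (LQ a b)"
    by (rule monoidI) (auto simp: quat_mult_def algebra_simps quat.expand)
qed (auto simp: quat_add_def quat_mult_def algebra_simps)

lemma LQ_relations:
  fixes a b :: int
  defines "i \<equiv> Quat 0 1 0 0" and "j \<equiv> Quat 0 0 1 0" and "k \<equiv> Quat 0 0 0 1"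
  shows "i \<otimes>\<^bsub>LQ a b\<^esub> i = Quat (- a) 0 0 0"
    and "j \<otimes>\<^bsub>LQ a b\<^esub> j = Quat (- b) 0 0 0"
    and "i \<otimes>\<^bsub>LQ a b\<^esub> j = k"
    and "j \<otimes>\<^bsub>LQ a b\<^esub> i = \<ominus>\<^bsub>LQ a b\<^esub> k"
    and "k \<otimes>\<^bsub>LQ a b\<^esub> k = Quat (- (a * b)) 0 0 0"
proof -
  interpret ring "LQ a b" by (rule ring_LQ)
  have "\<ominus>\<^bsub>LQ a b\<^esub> k = Quat 0 0 0 (- 1)"
    by (rule minus_equality) (auto simp: k_def quat_add_def)
  then show "j \<otimes>\<^bsub>LQ a b\<^esub> i = \<ominus>\<^bsub>LQ a b\<^esub> k"
    by (simp add: i_def j_def quat_mult_def)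
qed (simp_all add: i_def j_def k_def quat_mult_def)

definition LQ_cubes :: "int \<Rightarrow> int \<Rightarrow> quat set" where
  "LQ_cubes a b = {x [^]\<^bsub>LQ a b\<^esub> (3::nat) | x. x \<in> carrier (LQ a b)}"

definition LQ3 :: "int \<Rightarrow> int \<Rightarrow> quat set" where
  "LQ3 a b = generate (add_monoid (LQ a b)) (LQ_cubes a b)"

definition sum_of_at_most_cubes :: "int \<Rightarrow> int \<Rightarrow> nat \<Rightarrow> quat \<Rightarrow> bool" where
  "sum_of_at_most_cubes a b g q \<longleftrightarrow>
     (\<exists>n\<le>g. \<exists>x. (\<forall>m<n. x m \<in> carrier (LQ a b)) \<and>
        q = (\<Oplus>\<^bsub>LQ a b\<^esub>m\<in>{..<n}. x m [^]\<^bsub>LQ a b\<^esub> (3::nat)))"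

definition cubes_suffice :: "int \<Rightarrow> int \<Rightarrow> nat \<Rightarrow> bool" where
  "cubes_suffice a b g \<longleftrightarrow> 0 < g \<and> (\<forall>q\<in>LQ3 a b. sum_of_at_most_cubes a b g q)"

text \<open>Only meaningful when some \<open>g\<close> with \<open>cubes_suffice a b g\<close> exists.\<close>

definition waring_g3 :: "int \<Rightarrow> int \<Rightarrow> nat" where
  "waring_g3 a b = (LEAST g. cubes_suffice a b g)"

end

theory Submission
  imports Defs "HOL-Number_Theory.Cong" "HOL-Computational_Algebra.Primes"
begin

text \<open>
  Write a quaternion as \<open>(t, v)\<close> with real part \<open>t\<close> and vector part \<open>v\<close>, and let
  \<open>N(v) = -v\<^sup>2\<close>, with polar form \<open>\<langle>_, _\<rangle>\<close>. Then \<open>(t, v)\<^sup>3 = (t\<^sup>3 - 3tN(v), (3t\<^sup>2 - N(v))v)\<close>.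

  The lower bounds are congruences modulo 9: the number 3 is never a sum of two cubes, and 4 is
  not a sum of three if 3 divides \<open>a\<close> and \<open>b\<close>. For the upper bounds,
  \<open>6x = (x+1)\<^sup>3 + (x-1)\<^sup>3 + 2(-x)\<^sup>3\<close>, so four cubes represent every multiple of 6. If 3 does not
  divide both \<open>a\<close> and \<open>b\<close>, every quaternion is a sum of two cubes modulo 6, and six cubes suffice.

  If 3 divides \<open>a\<close> and \<open>b\<close>, an element of the cube subgroup is \<open>q = (r, 3u)\<close>. If \<open>r + N(u)\<close>
  is odd, then \<open>q - q\<^sup>3\<close> is divisible by 6. Otherwise \<open>q\<close> need not be a cube modulo 6, and the
  four remaining cubes come from
  \<open>(\<xi>+1, g+w)\<^sup>3 + (\<xi>-1, w)\<^sup>3 - (\<xi>, g+w)\<^sup>3 - (\<xi>, w)\<^sup>3 = (6\<xi>(1+N(g)) - 3\<langle>g,u'\<rangle>, 3u')\<close> with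
  \<open>u' = (2\<xi>+1)g + 2w\<close>, whose real part is linear in \<open>\<xi>\<close> once \<open>u'\<close> is fixed. Take
  \<open>g = Ku\<close> with \<open>K\<close> odd and subtract from \<open>q\<close> the cube of \<open>(m, mg + ce)\<close>, where \<open>e\<close> is
  orthogonal to \<open>u\<close>: modulo \<open>M = 1 + N(g)\<close> the remaining condition becomes
  \<open>r + 3KN(u) + 2mc\<^sup>2N(e) \<equiv> 0\<close>, linear in \<open>m\<close>. It is solvable if \<open>N(e)\<close> is prime to the odd part
  of \<open>M\<close> and the 2-part of \<open>2M\<close> divides \<open>r + 3KN(u)\<close>, and \<open>K\<close> can be chosen to ensure both.
\<close>

section \<open>Cubes through the norm form, and peeling one cube off a sum\<close>

definition vnorm :: "int \<Rightarrow> int \<Rightarrow> quat \<Rightarrow> int" where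
  "vnorm a b x = a * qi x ^ 2 + b * qj x ^ 2 + a * b * qk x ^ 2"

definition vinner :: "int \<Rightarrow> int \<Rightarrow> quat \<Rightarrow> quat \<Rightarrow> int" where
  "vinner a b x y = a * qi x * qi y + b * qj x * qj y + a * b * qk x * qk y"

definition qcube :: "int \<Rightarrow> int \<Rightarrow> quat \<Rightarrow> quat" where
  "qcube a b x = Quat (qre x ^ 3 - 3 * qre x * vnorm a b x)
     ((3 * qre x ^ 2 - vnorm a b x) * qi x)
     ((3 * qre x ^ 2 - vnorm a b x) * qj x)
     ((3 * qre x ^ 2 - vnorm a b x) * qk x)"

lemma LQ_cube: "x [^]\<^bsub>LQ a b\<^esub> (3::nat) = qcube a b x"
proof -
  interpret ring "LQ a b" by (rule ring_LQ)
  have "x [^]\<^bsub>LQ a b\<^esub> (3::nat) = quat_mult a b (quat_mult a b x x) x"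
    by (simp add: numeral_3_eq_3 quat_mult_def)
  then show ?thesis
    by (simp add: quat_mult_def qcube_def vnorm_def algebra_simps power2_eq_square power3_eq_cube)
qed

lemma sum_of_at_most_cubes_0: "sum_of_at_most_cubes a b 0 q \<longleftrightarrow> q = Quat 0 0 0 0"
proof -
  interpret ring "LQ a b" by (rule ring_LQ)
  show ?thesis by (simp add: sum_of_at_most_cubes_def)
qed

lemma sum_of_at_most_cubes_Suc:
  "sum_of_at_most_cubes a b (Suc g) q \<longleftrightarrow>
     (\<exists>z q'. sum_of_at_most_cubes a b g q' \<and> q = quat_add (qcube a b z) q')"
    (is "?L \<longleftrightarrow> ?R")
proof -
  interpret ring "LQ a b" by (rule ring_LQ)
  have split: "(\<Oplus>\<^bsub>LQ a b\<^esub>m\<in>{..<Suc n}. x m [^]\<^bsub>LQ a b\<^esub> (3::nat)) =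
      quat_add (qcube a b (x n)) (\<Oplus>\<^bsub>LQ a b\<^esub>m\<in>{..<n}. x m [^]\<^bsub>LQ a b\<^esub> (3::nat))" for n x
    using finsum_insert[of "{..<n}" n "\<lambda>m. x m [^]\<^bsub>LQ a b\<^esub> (3::nat)"]
    by (simp add: lessThan_Suc LQ_cube)
  show ?thesis
  proof
    assume ?L
    then obtain n x where n: "n \<le> Suc g"
      and q: "q = (\<Oplus>\<^bsub>LQ a b\<^esub>m\<in>{..<n}. x m [^]\<^bsub>LQ a b\<^esub> (3::nat))"
      by (auto simp: sum_of_at_most_cubes_def)
    show ?R
    proof (cases n)
      case 0
      \<comment> \<open>The empty sum has no cube to split off, so it is padded with the cube of
        0.\<close>
      have "sum_of_at_most_cubes a b g (Quat 0 0 0 0)"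
        unfolding sum_of_at_most_cubes_def by (rule exI[of _ 0]) simp
      moreover have "q = quat_add (qcube a b (Quat 0 0 0 0)) (Quat 0 0 0 0)"
        using q 0 by (simp add: quat_add_def qcube_def)
      ultimately show ?R by blast
    next
      case (Suc m)
      have "sum_of_at_most_cubes a b g (\<Oplus>\<^bsub>LQ a b\<^esub>i\<in>{..<m}. x i [^]\<^bsub>LQ a b\<^esub> (3::nat))"
        unfolding sum_of_at_most_cubes_def using n Suc by (intro exI[of _ m]) auto
      then show ?R using q Suc split by blast
    qed
  next
    assume ?R
    then obtain z n x where n: "n \<le> g"
      and q: "q = quat_add (qcube a b z) (\<Oplus>\<^bsub>LQ a b\<^esub>m\<in>{..<n}. x m [^]\<^bsub>LQ a b\<^esub> (3::nat))"
      by (auto simp: sum_of_at_most_cubes_def)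
    have "(\<Oplus>\<^bsub>LQ a b\<^esub>m\<in>{..<n}. (x(n := z)) m [^]\<^bsub>LQ a b\<^esub> (3::nat)) =
        (\<Oplus>\<^bsub>LQ a b\<^esub>m\<in>{..<n}. x m [^]\<^bsub>LQ a b\<^esub> (3::nat))"
      by (rule finsum_cong') auto
    then have "q = (\<Oplus>\<^bsub>LQ a b\<^esub>m\<in>{..<Suc n}. (x(n := z)) m [^]\<^bsub>LQ a b\<^esub> (3::nat))"
      unfolding split q by simp
    then show ?L
      unfolding sum_of_at_most_cubes_def using n by (intro exI[of _ "Suc n"]) auto
  qed
qed

lemma sum_of_at_most_cubes_mono:
  "sum_of_at_most_cubes a b g q \<Longrightarrow> g \<le> h \<Longrightarrow> sum_of_at_most_cubes a b h q"
  unfolding sum_of_at_most_cubes_def using le_trans by blast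

lemma sum_of_four_cubesI:
  assumes "q = quat_add (qcube a b z1) (quat_add (qcube a b z2)
             (quat_add (qcube a b z3) (qcube a b z4)))"
  shows "sum_of_at_most_cubes a b 4 q"
proof -
  have add0: "quat_add x (Quat 0 0 0 0) = x" for x by (simp add: quat_add_def)
  have "sum_of_at_most_cubes a b (Suc 0) (qcube a b z4)"
    using sum_of_at_most_cubes_Suc sum_of_at_most_cubes_0 add0 by metis
  then have "sum_of_at_most_cubes a b (Suc (Suc (Suc (Suc 0)))) q"
    unfolding assms using sum_of_at_most_cubes_Suc by blast
  then show ?thesis by (simp add: eval_nat_numeral)
qed

section \<open>Polynomial identities for four cubes\<close>

lemma six_times_four_cubes: "sum_of_at_most_cubes a b 4 (Quat (6 * t) (6 * x) (6 * y) (6 * z))"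
  by (rule sum_of_four_cubesI[of _ _ _ "Quat (t + 1) x y z" "Quat (t - 1) x y z"
        "Quat (- t) (- x) (- y) (- z)" "Quat (- t) (- x) (- y) (- z)"])
     (simp add: quat_add_def qcube_def vnorm_def power2_eq_square power3_eq_cube algebra_simps)

text \<open>The parity hypotheses make \<open>u = (2 * \<xi> + 1) * g + 2 * w\<close> solvable for
  \<open>w\<close> on vector parts whatever \<open>\<xi>\<close> is, so \<open>\<xi>\<close> stays
  free while \<open>u\<close> is fixed.\<close>

lemma four_cubes_linear_in_real_part:
  assumes "even (qi u - qi g)" "even (qj u - qj g)" "even (qk u - qk g)"
  shows "sum_of_at_most_cubes a b 4
    (Quat (6 * \<xi> * (1 + vnorm a b g) - 3 * vinner a b g u) (3 * qi u) (3 * qj u) (3 * qk u))"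
proof -
  have ex: "\<exists>w. x = (2 * \<xi> + 1) * y + 2 * w" if "even (x - y)" for x y :: int
  proof -
    from that obtain k where "x - y = 2 * k" by (elim evenE)
    then show ?thesis by (intro exI[of _ "k - \<xi> * y"]) (simp add: algebra_simps)
  qed
  from ex[OF assms(1)] ex[OF assms(2)] ex[OF assms(3)] obtain w1 w2 w3
    where w: "qi u = (2 * \<xi> + 1) * qi g + 2 * w1" "qj u = (2 * \<xi> + 1) * qj g + 2 * w2"
      "qk u = (2 * \<xi> + 1) * qk g + 2 * w3" by auto
  show ?thesis
    by (rule sum_of_four_cubesI[of _ _ _ "Quat (\<xi> + 1) (qi g + w1) (qj g + w2) (qk g + w3)"
        "Quat (\<xi> - 1) w1 w2 w3" "Quat (- \<xi>) (- qi g - w1) (- qj g - w2) (- qk g - w3)"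
        "Quat (- \<xi>) (- w1) (- w2) (- w3)"])
      (simp add: quat_add_def qcube_def vnorm_def vinner_def w power2_eq_square
        power3_eq_cube algebra_simps)
qed

section \<open>Arithmetic behind the choice of \<open>K\<close>, \<open>c\<close> and
  \<open>m\<close>\<close>

text \<open>Supplies the multiplier in \<open>g = Ku\<close>, for \<open>N = N(u)\<close> and
  \<open>E = N(e)\<close>. If \<open>K\<close> is a multiple of the odd part of \<open>E\<close>,
  then \<open>1 + K ^ 2 * N\<close> is 1 modulo that odd part; as \<open>M\<close> is odd, this
  secures \<open>coprime E M\<close>.\<close>

lemma odd_multiplier_exists:
  fixes N E r :: int
  assumes N: "N \<ge> 0" and E: "E > 0" and par: "even (r + N)"
  shows "\<exists>K s M. odd K \<and> 2 * (1 + K ^ 2 * N) = 2 ^ s * M \<and> odd M \<and>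
    2 ^ s dvd r + 3 * K * N \<and> coprime E M \<and> s > 0"
proof -
  have two: "\<not> is_unit (2::int)" by simp
  obtain E' where E': "E = 2 ^ multiplicity 2 E * E'" "odd E'"
    using multiplicity_decompose'[of E 2] E two by auto
  have cop: "coprime E M" if K: "E' dvd K" and M: "2 * (1 + K ^ 2 * N) = 2 ^ s * M" "odd M"
    for K M :: int and s :: nat
  proof -
    from K obtain c where c: "K = E' * c" by (elim dvdE)
    have "coprime E' (1 + K ^ 2 * N)"
    proof (rule coprimeI)
      fix d assume d: "d dvd E'" "d dvd 1 + K ^ 2 * N"
      then have "d dvd K ^ 2 * N" using K by (simp add: power2_eq_square dvd_mult2 dvd_trans)
      then show "is_unit d" using d(2) by (simp add: dvd_add_left_iff)
    qed
    moreover have "coprime E' 2" using E'(2) by simp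
    ultimately have "coprime E' (2 ^ s * M)" unfolding M(1)[symmetric]
      by (simp only: coprime_mult_right_iff)
    then have "coprime E' M" by simp
    moreover have "coprime (2 ^ multiplicity 2 E) M" using M(2) by simp
    ultimately show ?thesis using E'(1) by (metis coprime_mult_left_iff)
  qed
  show ?thesis
  proof (cases "even N")
    case True
    \<comment> \<open>Here \<open>1 + K ^ 2 * N\<close> is odd and \<open>r\<close> is even, so
      \<open>s = 1\<close> and the smallest admissible multiple \<open>K = E'\<close>
      suffice.\<close>
    have "coprime E (1 + E' ^ 2 * N)" using True by (intro cop[of E' 1]) auto
    then show ?thesis using True E' par
      by (intro exI[of _ E'] exI[of _ 1] exI[of _ "1 + E' ^ 2 * N"]) auto
  next
    case False
    \<comment> \<open>If \<open>3KN \<equiv> -r\<close> modulo \<open>2\<^sup>j\<close>, then \<open>9N(1 + K\<^sup>2N) \<equiv> 9N + r\<^sup>2\<close>; the right-hand side is a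
      positive integer, so for large \<open>j\<close> the 2-part of \<open>2(1 + K\<^sup>2N)\<close> is at most \<open>2\<^sup>j\<close>.\<close>
    define j where "j = nat (2 * (9 * N + r ^ 2))"
    have N0: "N > 0" using False N by (cases "N = 0") auto
    then have pos: "2 * (9 * N + r ^ 2) > 0" by (simp add: add_pos_nonneg)
    then have j0: "j > 0" by (simp add: j_def)
    have "coprime (3 * E' * N) (2 ^ j)" using False E' by simp
    then obtain x where x: "[3 * E' * N * x = 1] (mod 2 ^ j)"
      using cong_solve_coprime_int by blast
    \<comment> \<open>The factor \<open>E'\<close> is for coprimality; \<open>x\<close> inverts
      \<open>3 * E' * N\<close>, which makes \<open>3 * K * N \<equiv> -r\<close> modulo
      \<open>2 ^ j\<close>.\<close>
    define K where "K = E' * (x * (- r))"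
    have "2 ^ j dvd (1 - 3 * E' * N * x) * r"
      using cong_sym[OF x] by (simp add: cong_iff_dvd_diff dvd_mult2)
    then have rho: "2 ^ j dvd r + 3 * K * N" by (simp add: K_def algebra_simps)
    have "even (r + 3 * K * N)" using rho j0 dvd_power[of j "2::int"] dvd_trans by blast
    then have oddK: "odd K" using False par by auto
    have M0: "2 * (1 + K ^ 2 * N) > 0" using N by (simp add: add_pos_nonneg)
    obtain M where M: "2 * (1 + K ^ 2 * N) = 2 ^ multiplicity 2 (2 * (1 + K ^ 2 * N)) * M" "odd M"
      using multiplicity_decompose'[of "2 * (1 + K ^ 2 * N)" 2] M0 two by auto
    define s where "s = multiplicity 2 (2 * (1 + K ^ 2 * N))"
    have Ms: "2 * (1 + K ^ 2 * N) = 2 ^ s * M" using M(1) by (simp add: s_def)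
    have s0: "s > 0"
    proof (rule ccontr)
      assume "\<not> s > 0"
      then have "2 * (1 + K ^ 2 * N) = M" using Ms by simp
      then show False using M(2) by (metis dvd_triv_left)
    qed
    have "s \<le> j"
    proof (rule ccontr)
      assume "\<not> s \<le> j"
      then have "(2::int) ^ j dvd 2 ^ s" by (simp add: le_imp_power_dvd)
      then have "2 ^ j dvd 2 * (1 + K ^ 2 * N)" unfolding Ms by (rule dvd_mult2)
      then have "2 ^ j dvd 2 * (1 + K ^ 2 * N) * (9 * N) + (r + 3 * K * N) * (2 * (r - 3 * K * N))"
        using rho by (rule dvd_add[OF dvd_mult2 dvd_mult2])
      also have "\<dots> = 2 * (9 * N + r ^ 2)" by (simp add: algebra_simps power2_eq_square)
      finally have "2 ^ j \<le> 2 * (9 * N + r ^ 2)" using pos by (intro zdvd_imp_le)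
      moreover have "int j < 2 ^ j" by (simp add: less_exp)
      ultimately show False using pos by (simp add: j_def)
    qed
    then have "2 ^ s dvd r + 3 * K * N" using rho by (meson dvd_trans le_imp_power_dvd)
    moreover have "coprime E M" using cop[OF _ Ms M(2)] by (simp add: K_def)
    ultimately show ?thesis using oddK Ms M(2) s0 by blast
  qed
qed

lemma cube_mod_9: "\<exists>s k. (t::int) = 3 * s + k \<and> k \<in> {- 1, 0, 1} \<and> (\<exists>c. t ^ 3 = 9 * c + k)"
proof -
  define s where "s = (t + 1) div 3"
  define k where "k = t - 3 * s"
  have k: "k \<in> {- 1, 0, 1}" unfolding k_def s_def by auto
  have t: "t = 3 * s + k" by (simp add: k_def)
  have "k ^ 3 = k" "k ^ 2 * s = k * (k * s)" using k by (auto simp: power2_eq_square)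
  then have "t ^ 3 = 9 * (3 * s ^ 3 + 3 * s ^ 2 * k + s * k ^ 2) + k"
    unfolding t by (simp add: power2_eq_square power3_eq_cube algebra_simps)
  then show ?thesis using t k by blast
qed

lemma cube_cong_mod_3: "3 dvd (t::int) ^ 3 - t"
proof -
  obtain s k c where "t = 3 * s + k" "t ^ 3 = 9 * c + k" using cube_mod_9 by blast
  then have "t ^ 3 - t = 3 * (3 * c - s)" by simp
  then show ?thesis by (rule dvdI)
qed

text \<open>The dividend is the real part of \<open>q - z^3\<close>, plus \<open>3<g,u'>\<close>,
  for \<open>z = (m, mg + ce)\<close>, arranged so that its last summand vanishes modulo
  \<open>1 + K ^ 2 * N\<close>. Divisibility provides \<open>\<xi>\<close>. Even \<open>c\<close>
  and \<open>m\<close> are needed for \<open>u'\<close> and \<open>g\<close> to agree modulo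
  2.\<close>

lemma multiplier_congruence:
  fixes N E r :: int
  assumes N: "N \<ge> 0" "3 dvd N" and E: "E > 0" "3 dvd E" and par: "even (r + N)"
  shows "\<exists>K c m. odd K \<and> even c \<and> even m \<and>
    6 * (1 + K ^ 2 * N) dvd r + 3 * K * N + 2 * m * c ^ 2 * E
      + (1 + K ^ 2 * N) * m * (m ^ 2 * K ^ 2 * N + c ^ 2 * E - m ^ 2)"
proof -
  obtain K M :: int and s where K: "odd K" and M: "2 * (1 + K ^ 2 * N) = 2 ^ s * M" "odd M"
    and rho: "2 ^ s dvd r + 3 * K * N" and EM: "coprime E M" and s: "s > 0"
    using odd_multiplier_exists[OF N(1) E(1) par] by blast
  \<comment> \<open>The witnesses are \<open>c = Q\<close> and \<open>Q * m\<close> in place of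
    \<open>m\<close>. The term linear in \<open>m\<close> becomes \<open>2 * Q ^ 3 * E * m\<close>,
    which vanishes modulo \<open>Q\<close> and has an invertible coefficient modulo
    \<open>M\<close>, where \<open>Q * M = 2 * (1 + K ^ 2 * N)\<close>.\<close>
  define Q :: int where "Q = 2 ^ s"
  have evQ: "even Q" using s by (simp add: Q_def)
  have copQ: "coprime Q M" using M(2) by (simp add: Q_def)
  have Q3: "coprime Q 3" by (simp add: Q_def)
  have M3: "coprime M 3"
  proof -
    have "coprime 3 (2 * (1 + K ^ 2 * N))"
    proof (rule prime_imp_coprime)
      show "\<not> 3 dvd 2 * (1 + K ^ 2 * N)" using N(2) by (auto elim!: dvdE) presburger
    qed simp
    then show ?thesis unfolding M(1) by (simp add: coprime_commute)
  qed
  have "coprime (2 * Q ^ 3 * E) M" using copQ EM M(2) by simp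
  then obtain x where x: "[2 * Q ^ 3 * E * x = 1] (mod M)"
    using cong_solve_coprime_int by blast
  define m0 where "m0 = - x * (r + 3 * K * N)"
  have "M dvd (1 - 2 * Q ^ 3 * E * x) * (r + 3 * K * N)"
    using cong_sym[OF x] by (simp add: cong_iff_dvd_diff dvd_mult2)
  then have m0: "M dvd r + 3 * K * N + 2 * Q ^ 3 * E * m0"
    by (simp add: m0_def algebra_simps)
  have "coprime (Q * M) 3" using Q3 M3 by simp
  then obtain y where y: "[Q * M * y = 1] (mod 3)"
    using cong_solve_coprime_int by blast
  \<comment> \<open>Shifting \<open>m0\<close> by a multiple of \<open>M\<close> keeps the
    congruence modulo \<open>M\<close> and achieves \<open>Q * m \<equiv> r\<close> modulo 3. Since
    3 divides \<open>N\<close> and \<open>E\<close>, the dividend \<open>W\<close> below reduces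
    modulo 3 to \<open>r - (Q * m) ^ 3\<close>, hence to 0.\<close>
  define m where "m = m0 + M * (y * (r - Q * m0))"
  have "3 dvd (1 - Q * M * y) * (r - Q * m0)"
    using cong_sym[OF y] by (simp add: cong_iff_dvd_diff dvd_mult2)
  then have m3: "3 dvd r - Q * m" by (simp add: m_def algebra_simps)
  have "M dvd (r + 3 * K * N + 2 * Q ^ 3 * E * m0) + M * (2 * Q ^ 3 * E * (y * (r - Q * m0)))"
    using m0 by simp
  then have mM: "M dvd r + 3 * K * N + 2 * Q ^ 3 * E * m" by (simp add: m_def algebra_simps)
  have "Q dvd r + 3 * K * N + 2 * Q ^ 3 * E * m"
    using rho by (simp add: Q_def[symmetric] power3_eq_cube)
  then have QM: "Q * M dvd r + 3 * K * N + 2 * Q ^ 3 * E * m"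
    using mM copQ by (simp add: divides_mult)
  define W where "W = r + 3 * K * N + 2 * (Q * m) * Q ^ 2 * E
      + (1 + K ^ 2 * N) * (Q * m) * ((Q * m) ^ 2 * K ^ 2 * N + Q ^ 2 * E - (Q * m) ^ 2)"
  have two: "2 * (1 + K ^ 2 * N) dvd W"
  proof -
    have "2 * (1 + K ^ 2 * N) dvd r + 3 * K * N + 2 * (Q * m) * Q ^ 2 * E"
      using QM M(1) by (simp add: Q_def[symmetric] power2_eq_square power3_eq_cube algebra_simps)
    moreover have "2 * (1 + K ^ 2 * N) dvd (1 + K ^ 2 * N) * (Q * m) * X" for X
    proof -
      obtain Q' where "Q = 2 * Q'" using evQ by (elim evenE)
      then have "(1 + K ^ 2 * N) * (Q * m) * X = 2 * (1 + K ^ 2 * N) * (Q' * m * X)" by simp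
      then show ?thesis by (rule dvdI)
    qed
    ultimately show ?thesis unfolding W_def by (rule dvd_add)
  qed
  have three: "3 dvd W"
  proof -
    obtain n e where ne: "N = 3 * n" "E = 3 * e" using N(2) E(2) by (auto elim!: dvdE)
    obtain l where l: "r = Q * m + 3 * l" using m3 by (metis add.commute diff_add_cancel dvdE)
    define p where "p = Q * m"
    have "3 dvd p - p ^ 3" using cube_cong_mod_3[of p] by (metis dvd_minus_iff minus_diff_eq)
    moreover have "W = (p - p ^ 3) + 3 * (l + 3 * K * n + 2 * p * Q ^ 2 * e
        + (1 + K ^ 2 * N) * p * (p ^ 2 * K ^ 2 * n + Q ^ 2 * e) - K ^ 2 * n * p ^ 3)"
      by (simp add: W_def p_def[symmetric] ne l power2_eq_square power3_eq_cube algebra_simps)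
    ultimately show ?thesis by (simp add: dvd_add)
  qed
  have "coprime 3 (2 * (1 + K ^ 2 * N))" unfolding M(1) using M3 by (simp add: coprime_commute)
  with three two have "3 * (2 * (1 + K ^ 2 * N)) dvd W" by (rule divides_mult)
  then show ?thesis using K evQ unfolding W_def
    by (intro exI[of _ K] exI[of _ Q] exI[of _ "Q * m"]) simp
qed

section \<open>Five cubes when 3 divides \<open>a\<close> and \<open>b\<close>\<close>

lemma cube_cong_mod_6: "6 dvd (t::int) ^ 3 - t"
proof -
  have "2 dvd t ^ 3 - t" by simp
  then have "2 * 3 dvd t ^ 3 - t" by (intro divides_mult cube_cong_mod_3) auto
  then show ?thesis by simp
qed

lemma ex_orthogonal_vector:
  assumes "a > 0" "b > 0"
  shows "\<exists>e. vinner a b u e = 0 \<and> vnorm a b e > 0"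
proof (cases "qi u = 0 \<and> qj u = 0")
  case True
  then show ?thesis using assms
    by (intro exI[of _ "Quat 0 1 0 0"]) (simp add: vinner_def vnorm_def)
next
  case False
  have "b ^ 2 * qj u ^ 2 > 0 \<or> a ^ 2 * qi u ^ 2 > 0" using False assms by auto
  then have "a * (b * qj u) ^ 2 + b * (a * qi u) ^ 2 > 0"
    using assms by (auto simp: power_mult_distrib intro: add_pos_nonneg add_nonneg_pos)
  then show ?thesis
    \<comment> \<open>The witness is the \<open>i\<close>, \<open>j\<close> component of
      \<open>u\<close> turned by a right angle with respect to the form
      \<open>a x^2 + b y^2\<close>.\<close>
    by (intro exI[of _ "Quat 0 (b * qj u) (- a * qi u) 0"]) (simp add: vinner_def vnorm_def)
qed

lemma five_cubes:
  assumes a: "a > 0" "3 dvd a" and b: "b > 0" "3 dvd b"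
  shows "sum_of_at_most_cubes a b 5 (Quat r (3 * u1) (3 * u2) (3 * u3))"
proof -
  define u where "u = Quat 0 u1 u2 u3"
  define N where "N = vnorm a b u"
  define q where "q = Quat r (3 * u1) (3 * u2) (3 * u3)"
  have N3: "3 dvd vnorm a b x" for x using a b by (simp add: vnorm_def)
  have "\<exists>z q'. sum_of_at_most_cubes a b 4 q' \<and> q = quat_add (qcube a b z) q'"
  proof (cases "even (r + N)")
    case False
    have nq: "vnorm a b q = 9 * N"
      by (simp add: vnorm_def N_def u_def q_def algebra_simps power2_eq_square)
    have "even (r * N)" using False by auto
    then obtain h where "r * N = 2 * h" by (elim evenE)
    then have "6 dvd 27 * (r * N)" by simp
    then have "6 dvd 27 * (r * N) - (r ^ 3 - r)" using cube_cong_mod_6 by (rule dvd_diff)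
    then obtain k where k: "27 * (r * N) - (r ^ 3 - r) = 6 * k" by (elim dvdE)
    have "even (1 - 3 * r ^ 2 + 9 * N)" using False by auto
    then obtain l where l: "1 - 3 * r ^ 2 + 9 * N = 2 * l" by (elim evenE)
    have vec: "3 * w = (3 * r ^ 2 - 9 * N) * (3 * w) + 6 * (l * w)" for w
    proof -
      have "3 * w * (1 - 3 * r ^ 2 + 9 * N) = 3 * w * (2 * l)" unfolding l ..
      then show ?thesis by (simp add: algebra_simps)
    qed
    have "q = quat_add (qcube a b q) (Quat (6 * k) (6 * (l * u1)) (6 * (l * u2)) (6 * (l * u3)))"
      unfolding quat_add_def qcube_def nq using k vec[of u1] vec[of u2] vec[of u3]
      by (simp add: q_def algebra_simps)
    then show ?thesis using six_times_four_cubes by blast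
  next
    case True
    obtain e where e: "vinner a b u e = 0" "vnorm a b e > 0"
      using ex_orthogonal_vector a b by blast
    define E where "E = vnorm a b e"
    have "N \<ge> 0" using a b by (simp add: N_def vnorm_def)
    then obtain K c m where odd: "odd K" and ev: "even c" "even m"
      and dvd: "6 * (1 + K ^ 2 * N) dvd r + 3 * K * N + 2 * m * c ^ 2 * E
        + (1 + K ^ 2 * N) * m * (m ^ 2 * K ^ 2 * N + c ^ 2 * E - m ^ 2)"
      using multiplier_congruence[of N E r] N3 e(2) True unfolding N_def E_def by blast
    define n where "n = m ^ 2 * K ^ 2 * N + c ^ 2 * E"
    obtain \<xi> where \<xi>: "r + 3 * K * N + 2 * m * c ^ 2 * E + (1 + K ^ 2 * N) * m * (n - m ^ 2)
        = 6 * (1 + K ^ 2 * N) * \<xi>" using dvd unfolding n_def by (elim dvdE)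
    have "3 dvd n" using N3 by (simp add: n_def N_def E_def)
    then obtain n' where n': "n = 3 * n'" by (elim dvdE)
    define g where "g = Quat 0 (K * u1) (K * u2) (K * u3)"
    define z where "z = Quat m (m * K * u1 + c * qi e) (m * K * u2 + c * qj e) (m * K * u3 + c * qk e)"
    \<comment> \<open>Since \<open>n = 3 * n'\<close>, the cube of \<open>z\<close> has vector part
      \<open>3 * (m ^ 2 - n')\<close> times that of \<open>z\<close>; thus \<open>3 u'\<close> is
      the vector part of \<open>q - z^3\<close>.\<close>
    define u' where "u' = Quat 0 (u1 - (m ^ 2 - n') * qi z) (u2 - (m ^ 2 - n') * qj z)
      (u3 - (m ^ 2 - n') * qk z)"
    have ng: "vnorm a b g = K ^ 2 * N"
      by (simp add: vnorm_def N_def u_def g_def algebra_simps power2_eq_square)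
    have "vnorm a b z = n + 2 * m * K * c * vinner a b u e"
      by (simp add: vnorm_def vinner_def N_def E_def u_def z_def n_def algebra_simps power2_eq_square)
    then have nz: "vnorm a b z = n" using e by simp
    have "vinner a b g u' = K * N - (m ^ 2 - n') * (m * K ^ 2 * N + K * c * vinner a b u e)"
      by (simp add: vnorm_def vinner_def N_def u_def z_def g_def u'_def algebra_simps power2_eq_square)
    then have gu: "vinner a b g u' = K * N - (m ^ 2 - n') * (m * K ^ 2 * N)" using e by simp
    \<comment> \<open>As \<open>m\<close> and \<open>c\<close> are even, \<open>z\<close> has an
      even vector part, so \<open>u'\<close> agrees with \<open>u\<close> modulo 2, and
      \<open>u\<close> with \<open>Ku\<close> because \<open>K\<close> is odd.\<close>
    have par: "even (x - (m ^ 2 - n') * (m * K * x + c * y) - K * x)" for x y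
      using odd ev by simp
    have four: "sum_of_at_most_cubes a b 4
      (Quat (6 * \<xi> * (1 + vnorm a b g) - 3 * vinner a b g u') (3 * qi u') (3 * qj u') (3 * qk u'))"
      by (rule four_cubes_linear_in_real_part) (use par in \<open>simp_all add: u'_def g_def z_def\<close>)
    have "6 * \<xi> * (1 + K ^ 2 * N) =
        r + 3 * K * N + 2 * m * c ^ 2 * E + (1 + K ^ 2 * N) * m * (n - m ^ 2)"
      unfolding \<xi> by simp
    also have "\<dots> = r - m ^ 3 + 3 * m * n + 3 * K * N - (3 * m ^ 2 - n) * (m * K ^ 2 * N)"
      by (simp add: n_def algebra_simps power2_eq_square power3_eq_cube)
    finally have "r = m ^ 3 - 3 * m * n + (6 * \<xi> * (1 + vnorm a b g) - 3 * vinner a b g u')"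
      unfolding ng gu n' by (simp add: algebra_simps)
    then have "q = quat_add (qcube a b z) (Quat (6 * \<xi> * (1 + vnorm a b g) - 3 * vinner a b g u')
        (3 * qi u') (3 * qj u') (3 * qk u'))"
      unfolding quat_add_def qcube_def nz n' by (simp add: q_def u'_def z_def algebra_simps)
    then show ?thesis using four by blast
  qed
  then have "sum_of_at_most_cubes a b (Suc 4) q" unfolding sum_of_at_most_cubes_Suc .
  then show ?thesis by (simp add: q_def)
qed

text \<open>In a cube the vector part carries the factor \<open>3t^2 - N\<close>, and here 3 divides
  every norm \<open>N\<close>.\<close>

lemma LQ3_vector_part_dvd_3:
  assumes "3 dvd a" "3 dvd b" "q \<in> LQ3 a b"
  shows "3 dvd qi q \<and> 3 dvd qj q \<and> 3 dvd qk q"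
proof -
  interpret ring "LQ a b" by (rule ring_LQ)
  have cube: "3 dvd qi h \<and> 3 dvd qj h \<and> 3 dvd qk h" if "h \<in> LQ_cubes a b" for h
  proof -
    from that obtain x where h: "h = qcube a b x" by (auto simp: LQ_cubes_def LQ_cube)
    have "3 dvd 3 * qre x ^ 2 - vnorm a b x" using assms(1,2) by (simp add: vnorm_def)
    then show ?thesis by (simp add: h qcube_def)
  qed
  have inv_eq: "inv\<^bsub>add_monoid (LQ a b)\<^esub> h = Quat (- qre h) (- qi h) (- qj h) (- qk h)" for h
    unfolding a_inv_def[symmetric] by (rule minus_equality) (auto simp: quat_add_def)
  from assms(3) show ?thesis unfolding LQ3_def
  proof (induction rule: generate.induct)
    case (inv h)
    then show ?case using cube[of h] unfolding inv_eq by simp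
  qed (use cube in \<open>auto simp: quat_add_def\<close>)
qed

section \<open>Six cubes in the other case: representations modulo 2 and 3\<close>

definition qcong :: "int \<Rightarrow> quat \<Rightarrow> quat \<Rightarrow> bool" where
  "qcong m x y \<longleftrightarrow> [qre x = qre y] (mod m) \<and> [qi x = qi y] (mod m) \<and>
     [qj x = qj y] (mod m) \<and> [qk x = qk y] (mod m)"

lemma qcong_trans: "qcong m x y \<Longrightarrow> qcong m y z \<Longrightarrow> qcong m x z"
  unfolding qcong_def by (meson cong_trans)

lemma qcong_add: "qcong m x x' \<Longrightarrow> qcong m y y' \<Longrightarrow> qcong m (quat_add x y) (quat_add x' y')"
  by (simp add: qcong_def quat_add_def cong_add)

lemma qcong_qcube: "qcong m x y \<Longrightarrow> qcong m (qcube a b x) (qcube a b y)"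
  unfolding qcong_def qcube_def vnorm_def
  by (auto intro!: cong_add cong_diff cong_mult cong_pow)

text \<open>Modulo 3 the cube of \<open>(t, v)\<close> is \<open>(t, -N(v) v)\<close>. Replacing
  \<open>v\<close> by \<open>-Nv\<close>, whose norm is \<open>N^3\<close>, turns the vector part
  into \<open>N^4 v\<close>, and \<open>N^4 \<equiv> 1\<close>.\<close>

lemma one_cube_mod_3:
  assumes "\<not> 3 dvd vnorm a b q"
  shows "\<exists>z. qcong 3 (qcube a b z) q"
proof
  define N where "N = vnorm a b q"
  define z where "z = Quat (qre q) (- N * qi q) (- N * qj q) (- N * qk q)"
  have nz: "vnorm a b z = N ^ 3"
    by (simp add: vnorm_def[of a b z] z_def power_mult_distrib)
       (simp add: N_def vnorm_def power2_eq_square power3_eq_cube algebra_simps)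
  have "3 dvd N * (N ^ 2 - 1)" using cube_cong_mod_3[of N]
    by (simp add: power2_eq_square power3_eq_cube algebra_simps)
  then have "3 dvd N ^ 2 - 1" using assms by (simp add: N_def prime_dvd_mult_iff)
  then obtain k where k: "N ^ 2 = 3 * k + 1" by (metis dvdE diff_add_cancel)
  have "N ^ 4 = (N ^ 2) ^ 2" by simp
  also have "\<dots> = 3 * (3 * k ^ 2 + 2 * k) + 1" unfolding k by (simp add: power2_eq_square algebra_simps)
  finally have N4: "N ^ 4 = 3 * (3 * k ^ 2 + 2 * k) + 1" .
  have vec: "[(3 * qre q ^ 2 - N ^ 3) * (- N * w) = w] (mod 3)" for w
  proof -
    have "(3 * qre q ^ 2 - N ^ 3) * (- N * w) - w = N ^ 4 * w - w - 3 * (qre q ^ 2 * N * w)"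
      by (simp add: power4_eq_xxxx power3_eq_cube algebra_simps)
    also have "\<dots> = 3 * ((3 * k ^ 2 + 2 * k) * w - qre q ^ 2 * N * w)"
      unfolding N4 by (simp add: algebra_simps)
    finally show ?thesis by (simp add: cong_iff_dvd_diff)
  qed
  have "3 dvd (qre q ^ 3 - qre q) - 3 * (qre q * N ^ 3)"
    by (rule dvd_diff[OF cube_cong_mod_3]) simp
  then show "qcong 3 (qcube a b z) q"
    unfolding qcong_def qcube_def nz using vec
    by (simp add: z_def) (simp add: cong_iff_dvd_diff algebra_simps)
qed

lemma two_cubes_mod_3:
  assumes "\<not> 3 dvd a \<or> \<not> 3 dvd b"
  shows "\<exists>z1 z2. qcong 3 (quat_add (qcube a b z1) (qcube a b z2)) q"
proof (cases "3 dvd vnorm a b q")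
  case False
  then obtain z where "qcong 3 (qcube a b z) q" using one_cube_mod_3 by blast
  then show ?thesis
    by (intro exI[of _ z] exI[of _ "Quat 0 0 0 0"]) (simp add: quat_add_def qcube_def qcong_def)
next
  case True
  have "\<exists>s t :: int. \<not> 3 dvd vnorm a b (Quat 0 s t 0) \<and>
      \<not> 3 dvd vnorm a b (Quat (qre q) (qi q - s) (qj q - t) (qk q))"
  proof -
    \<comment> \<open>When 3 divides \<open>N(q)\<close>, subtracting \<open>s\<close> times
      \<open>i\<close> (or \<open>j\<close>) with \<open>s = \<plusminus>1\<close> leaves norm
      \<open>c * (1 - 2 * s * w)\<close> modulo 3, where \<open>c\<close> is \<open>a\<close> (or
      \<open>b\<close>). The values \<open>1 - 2w\<close> and \<open>1 + 2w\<close> add up to 2, so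
      one sign works.\<close>
    have sign: "\<exists>s::int. s ^ 2 = 1 \<and> \<not> 3 dvd c * (1 - 2 * s * w)" if "\<not> 3 dvd c" for c w :: int
    proof (cases "3 dvd 1 - 2 * w")
      case True
      then have "\<not> 3 dvd 1 + 2 * w" by presburger
      then show ?thesis using that by (intro exI[of _ "- 1"]) (simp add: prime_dvd_mult_iff)
    next
      case False
      then show ?thesis using that by (intro exI[of _ 1]) (simp add: prime_dvd_mult_iff)
    qed
    from assms show ?thesis
    proof
      assume a: "\<not> 3 dvd a"
      then obtain s :: int where s: "s ^ 2 = 1" "\<not> 3 dvd a * (1 - 2 * s * qi q)" using sign by blast
      have "vnorm a b (Quat (qre q) (qi q - s) (qj q - 0) (qk q)) =
          vnorm a b q + a * (s ^ 2 - 2 * s * qi q)"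
        by (simp add: vnorm_def power2_eq_square algebra_simps)
      then have "\<not> 3 dvd vnorm a b (Quat (qre q) (qi q - s) (qj q - 0) (qk q))"
        using s True by (simp add: dvd_add_right_iff)
      moreover have "\<not> 3 dvd vnorm a b (Quat 0 s 0 0)" using a s by (simp add: vnorm_def)
      ultimately show ?thesis by blast
    next
      assume b: "\<not> 3 dvd b"
      then obtain s :: int where s: "s ^ 2 = 1" "\<not> 3 dvd b * (1 - 2 * s * qj q)" using sign by blast
      have "vnorm a b (Quat (qre q) (qi q - 0) (qj q - s) (qk q)) =
          vnorm a b q + b * (s ^ 2 - 2 * s * qj q)"
        by (simp add: vnorm_def power2_eq_square algebra_simps)
      then have "\<not> 3 dvd vnorm a b (Quat (qre q) (qi q - 0) (qj q - s) (qk q))"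
        using s True by (simp add: dvd_add_right_iff)
      moreover have "\<not> 3 dvd vnorm a b (Quat 0 0 s 0)" using b s by (simp add: vnorm_def)
      ultimately show ?thesis by blast
    qed
  qed
  then obtain s t where st: "\<not> 3 dvd vnorm a b (Quat 0 s t 0)"
      "\<not> 3 dvd vnorm a b (Quat (qre q) (qi q - s) (qj q - t) (qk q))" by blast
  obtain z1 z2 where "qcong 3 (qcube a b z1) (Quat 0 s t 0)"
      "qcong 3 (qcube a b z2) (Quat (qre q) (qi q - s) (qj q - t) (qk q))"
    using one_cube_mod_3 st by blast
  then have "qcong 3 (quat_add (qcube a b z1) (qcube a b z2))
      (quat_add (Quat 0 s t 0) (Quat (qre q) (qi q - s) (qj q - t) (qk q)))"
    by (rule qcong_add)
  then show ?thesis by (auto simp: quat_add_def)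
qed

text \<open>If \<open>t + N\<close> is odd, then \<open>tN\<close> is even and the vector factor
  \<open>3t^2 - N\<close> is odd.\<close>

lemma one_cube_mod_2:
  assumes "odd (qre q + vnorm a b q)"
  shows "qcong 2 (qcube a b q) q"
proof -
  have "even (qre q ^ 3 - 3 * qre q * vnorm a b q - qre q)" using assms by auto
  moreover have "even ((3 * qre q ^ 2 - vnorm a b q) * w - w)" for w using assms by auto
  ultimately show ?thesis by (simp add: qcong_def qcube_def cong_iff_dvd_diff)
qed

lemma two_cubes_mod_2: "\<exists>z1 z2. qcong 2 (quat_add (qcube a b z1) (qcube a b z2)) q"
proof (cases "odd (qre q + vnorm a b q)")
  case True
  then show ?thesis using one_cube_mod_2[OF True]
    by (intro exI[of _ q] exI[of _ "Quat 0 0 0 0"]) (simp add: quat_add_def qcube_def qcong_def)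
next
  case False
  \<comment> \<open>Removing the cube 1 flips the parity of the real part and leaves the norm of the
    vector part unchanged.\<close>
  define q1 where "q1 = Quat (qre q - 1) (qi q) (qj q) (qk q)"
  have "odd (qre q1 + vnorm a b q1)" using False by (simp add: q1_def vnorm_def)
  from qcong_add[OF one_cube_mod_2[OF this] one_cube_mod_2[of "Quat 1 0 0 0" a b]]
  have "qcong 2 (quat_add (qcube a b q1) (qcube a b (Quat 1 0 0 0))) (quat_add q1 (Quat 1 0 0 0))"
    by (simp add: vnorm_def)
  then show ?thesis by (auto simp: q1_def quat_add_def)
qed

lemma quat_chinese_remainder: "\<exists>z. qcong 2 z x \<and> qcong 3 z y"
proof -
  have "[3 * s - 2 * t = s] (mod 2)" "[3 * s - 2 * t = t] (mod 3)" for s t :: int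
    by (simp_all add: cong_iff_dvd_diff algebra_simps)
  then show ?thesis
    by (intro exI[of _ "Quat (3 * qre x - 2 * qre y) (3 * qi x - 2 * qi y)
      (3 * qj x - 2 * qj y) (3 * qk x - 2 * qk y)"]) (simp add: qcong_def)
qed

lemma six_cubes:
  assumes "\<not> 3 dvd a \<or> \<not> 3 dvd b"
  shows "sum_of_at_most_cubes a b 6 q"
proof -
  obtain x1 x2 where x: "qcong 2 (quat_add (qcube a b x1) (qcube a b x2)) q"
    using two_cubes_mod_2 by blast
  obtain y1 y2 where y: "qcong 3 (quat_add (qcube a b y1) (qcube a b y2)) q"
    using two_cubes_mod_3[OF assms] by blast
  obtain z1 where z1: "qcong 2 z1 x1" "qcong 3 z1 y1" using quat_chinese_remainder by blast
  obtain z2 where z2: "qcong 2 z2 x2" "qcong 3 z2 y2" using quat_chinese_remainder by blast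
  define p where "p = quat_add (qcube a b z1) (qcube a b z2)"
  have p2: "qcong 2 p q" unfolding p_def
    by (rule qcong_trans[OF qcong_add[OF qcong_qcube[OF z1(1)] qcong_qcube[OF z2(1)]] x])
  have p3: "qcong 3 p q" unfolding p_def
    by (rule qcong_trans[OF qcong_add[OF qcong_qcube[OF z1(2)] qcong_qcube[OF z2(2)]] y])
  have six: "\<exists>k. t = s + 6 * k" if "[s = t] (mod 2)" "[s = t] (mod 3)" for s t :: int
  proof -
    have "2 dvd t - s" "3 dvd t - s"
      using that[THEN cong_sym] by (simp_all add: cong_iff_dvd_diff)
    then have "2 * 3 dvd t - s" by (intro divides_mult) auto
    then obtain k where "t - s = 6 * k" by (auto elim: dvdE)
    then show ?thesis by (intro exI[of _ k]) simp
  qed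
  obtain k0 k1 k2 k3 where "qre q = qre p + 6 * k0" "qi q = qi p + 6 * k1"
      "qj q = qj p + 6 * k2" "qk q = qk p + 6 * k3"
    using six p2 p3 unfolding qcong_def by meson
  then have "q = quat_add (qcube a b z1) (quat_add (qcube a b z2)
      (Quat (6 * k0) (6 * k1) (6 * k2) (6 * k3)))"
    by (simp add: p_def quat_add_def quat.expand)
  then have "sum_of_at_most_cubes a b (Suc (Suc 4)) q"
    using sum_of_at_most_cubes_Suc six_times_four_cubes by metis
  then show ?thesis by simp
qed

section \<open>Lower bounds modulo 9\<close>

text \<open>Modulo 3 the real parts force \<open>s \<equiv> -t\<close> and the vector parts force
  \<open>N \<equiv> M\<close>. Then 9 divides both \<open>t^3 + s^3\<close> and
  \<open>3(tN + sM)\<close>, hence the whole real part, but not 3.\<close>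

lemma three_not_sum_of_two_cubes: "\<not> sum_of_at_most_cubes a b 2 (Quat 3 0 0 0)"
proof
  assume "sum_of_at_most_cubes a b 2 (Quat 3 0 0 0)"
  then obtain y z where "Quat 3 0 0 0 =
      quat_add (qcube a b y) (quat_add (qcube a b z) (Quat 0 0 0 0))"
    by (auto simp: numeral_2_eq_2 sum_of_at_most_cubes_Suc sum_of_at_most_cubes_0)
  moreover define t s N M where "t = qre y" "s = qre z" "N = vnorm a b y" "M = vnorm a b z"
  ultimately have re: "3 = t ^ 3 - 3 * t * N + (s ^ 3 - 3 * s * M)"
    and vec: "(3 * t ^ 2 - N) * qi y + (3 * s ^ 2 - M) * qi z = 0"
      "(3 * t ^ 2 - N) * qj y + (3 * s ^ 2 - M) * qj z = 0"
      "(3 * t ^ 2 - N) * qk y + (3 * s ^ 2 - M) * qk z = 0"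
    by (simp_all add: quat_add_def qcube_def)
  have "t + s = 3 * (1 + t * N + s * M) - (t ^ 3 - t) - (s ^ 3 - s)"
    using re by (simp add: algebra_simps)
  then have "3 dvd t + s"
    using cube_cong_mod_3[of t] cube_cong_mod_3[of s] by (metis dvd_diff dvd_triv_left)
  then obtain k where "t + s = 3 * k" by (elim dvdE)
  then have k: "s = 3 * k - t" by simp
  have sq: "3 dvd (N * x) ^ 2 - (M * w) ^ 2" if "(3 * t ^ 2 - N) * x + (3 * s ^ 2 - M) * w = 0"
    for x w :: int
  proof -
    have "N * x + M * w = 3 * (t ^ 2 * x + s ^ 2 * w)" using that by (simp add: algebra_simps)
    then have "3 dvd (N * x + M * w) * (N * x - M * w)" by simp
    then show ?thesis by (simp add: power2_eq_square algebra_simps)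
  qed
  \<comment> \<open>The vector parts give \<open>N y \<equiv> -M z\<close> modulo 3; taking norms, \<open>N\<^sup>3 \<equiv> M\<^sup>3\<close>.\<close>
  have "N ^ 3 - M ^ 3 = a * ((N * qi y) ^ 2 - (M * qi z) ^ 2) +
      b * ((N * qj y) ^ 2 - (M * qj z) ^ 2) + a * b * ((N * qk y) ^ 2 - (M * qk z) ^ 2)"
  proof -
    have "N ^ 2 * N - M ^ 2 * M = N ^ 2 * vnorm a b y - M ^ 2 * vnorm a b z"
      by (simp add: \<open>N = _\<close> \<open>M = _\<close>)
    then show ?thesis
      by (simp add: vnorm_def power_mult_distrib power3_eq_cube power2_eq_square algebra_simps)
  qed
  then have "3 dvd N ^ 3 - M ^ 3" using vec[THEN sq] by simp
  then have "3 dvd (N ^ 3 - M ^ 3) - (N ^ 3 - N) + (M ^ 3 - M)"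
    by (rule dvd_add[OF dvd_diff[OF _ cube_cong_mod_3] cube_cong_mod_3])
  then have "3 dvd N - M" by simp
  then obtain l where "N - M = 3 * l" by (elim dvdE)
  then have l: "N = M + 3 * l" by simp
  have "3 = 9 * (k * t ^ 2 - 3 * k ^ 2 * t + 3 * k ^ 3 - t * l - k * M)"
    using re unfolding k l by (simp add: power2_eq_square power3_eq_cube algebra_simps)
  then show False by presburger
qed

text \<open>With 3 dividing \<open>N\<close>, the real part \<open>t^3 - 3tN\<close> is -1, 0 or 1
  modulo 9; three such residues never add up to 4.\<close>

lemma four_not_sum_of_three_cubes:
  assumes "3 dvd a" "3 dvd b"
  shows "\<not> sum_of_at_most_cubes a b 3 (Quat 4 0 0 0)"
proof
  have re: "\<exists>k. qre (qcube a b z) = 9 * k \<or> qre (qcube a b z) = 9 * k + 1 \<or>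
      qre (qcube a b z) = 9 * k - 1" for z
  proof -
    define t where "t = qre z"
    have "3 dvd vnorm a b z" using assms by (simp add: vnorm_def)
    then obtain n where n: "vnorm a b z = 3 * n" by (elim dvdE)
    have re: "qre (qcube a b z) = t ^ 3 - 9 * t * n" by (simp add: qcube_def n t_def)
    obtain c k where "t ^ 3 = 9 * c + k" "k \<in> {- 1, 0, 1}" using cube_mod_9[of t] by blast
    then show ?thesis unfolding re by (intro exI[of _ "c - t * n"]) (auto simp: algebra_simps)
  qed
  assume "sum_of_at_most_cubes a b 3 (Quat 4 0 0 0)"
  then obtain x y z where "Quat 4 0 0 0 = quat_add (qcube a b x) (quat_add (qcube a b y)
      (quat_add (qcube a b z) (Quat 0 0 0 0)))"
    by (auto simp: numeral_3_eq_3 sum_of_at_most_cubes_Suc sum_of_at_most_cubes_0)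
  then have "4 = qre (qcube a b x) + (qre (qcube a b y) + qre (qcube a b z))"
    by (simp add: quat_add_def)
  then show False using re[of x] re[of y] re[of z] by presburger
qed

section \<open>From representations to bounds on the least \<open>g\<close>\<close>

text \<open>Places the obstructions 3 and 4 in the cube subgroup, as repeated sums of the cube
  1.\<close>

lemma nat_in_LQ3: "Quat (int n) 0 0 0 \<in> LQ3 a b"
proof (induction n)
  case 0
  show ?case using generate.one[of "add_monoid (LQ a b)"] by (simp add: LQ3_def)
next
  case (Suc n)
  have "Quat 1 0 0 0 = qcube a b (Quat 1 0 0 0)" by (simp add: qcube_def vnorm_def)
  then have "Quat 1 0 0 0 \<in> LQ_cubes a b" by (auto simp: LQ_cubes_def LQ_cube)
  then have "Quat 1 0 0 0 \<in> LQ3 a b" unfolding LQ3_def by (rule generate.incl)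
  then show ?case using generate.eng[of _ "add_monoid (LQ a b)"] Suc
    by (fastforce simp: LQ3_def quat_add_def)
qed

lemma waring_g3_bounds:
  assumes "cubes_suffice a b h" "q \<in> LQ3 a b" "\<not> sum_of_at_most_cubes a b l q"
  shows "l < waring_g3 a b \<and> waring_g3 a b \<le> h"
proof -
  have "cubes_suffice a b (waring_g3 a b)"
    unfolding waring_g3_def using assms(1) by (rule LeastI)
  then have "sum_of_at_most_cubes a b (waring_g3 a b) q"
    using assms(2) by (simp add: cubes_suffice_def)
  then have "\<not> waring_g3 a b \<le> l" using assms(3) sum_of_at_most_cubes_mono by blast
  moreover have "waring_g3 a b \<le> h" unfolding waring_g3_def using assms(1) by (rule Least_le)
  ultimately show ?thesis by simp
qed

theorem mainTheorem1:
  fixes a b :: int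
  assumes "a > 0" and "b > 0"
  shows "(\<exists>g. cubes_suffice a b g) \<and>
    (\<not> 3 dvd a \<or> \<not> 3 dvd b \<longrightarrow> 3 \<le> waring_g3 a b \<and> waring_g3 a b \<le> 6) \<and>
    (3 dvd a \<and> 3 dvd b \<longrightarrow> 4 \<le> waring_g3 a b \<and> waring_g3 a b \<le> 5)"
proof (cases "3 dvd a \<and> 3 dvd b")
  case True
  have "sum_of_at_most_cubes a b 5 q" if "q \<in> LQ3 a b" for q
  proof -
    have "3 dvd qi q \<and> 3 dvd qj q \<and> 3 dvd qk q"
      using LQ3_vector_part_dvd_3 True that by blast
    then have "q = Quat (qre q) (3 * (qi q div 3)) (3 * (qj q div 3)) (3 * (qk q div 3))"
      by (simp add: quat.expand)
    also have "sum_of_at_most_cubes a b 5 \<dots>" using five_cubes True assms by blast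
    finally show ?thesis .
  qed
  then have "cubes_suffice a b 5" by (simp add: cubes_suffice_def)
  moreover have "Quat 4 0 0 0 \<in> LQ3 a b" using nat_in_LQ3[of 4 a b] by simp
  ultimately show ?thesis
    using waring_g3_bounds[of a b 5 "Quat 4 0 0 0" 3] four_not_sum_of_three_cubes[of a b] True
    by auto
next
  case False
  then have "cubes_suffice a b 6" by (simp add: cubes_suffice_def six_cubes)
  moreover have "Quat 3 0 0 0 \<in> LQ3 a b" using nat_in_LQ3[of 3 a b] by simp
  ultimately show ?thesis
    using waring_g3_bounds[of a b 6 "Quat 3 0 0 0" 2] three_not_sum_of_two_cubes[of a b] False
    by auto
qed

end
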